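(* Let $\rho$ be the unique real number $s>1$ with $\zeta(s)=2$, and let $c$ be the positive constant such that $A(x)\sim c\,x^{\rho}$ as $x\to\infty$, where $A(x)=\sum_{n\le x}a(n)$. Then \[ c=-\frac{2}{\rho\,\zeta'(\rho)}\lim_{k\to\infty}\sum_{d_1,d_2,\ldots,d_k>1}\frac{1}{\bigl(d_1+d_1d_2+\cdots+(d_1d_2\cdots d_k)\bigr)^{\rho}}, \] where for each positive integer $k$ the sum runs over all $k$-tuples $(d_1,\ldots,d_k)$ of integers greater than $1$ (in particular, the limit exists).
   Context: For a positive integer $n$, $a(n)$ denotes the number of partitions of $n$ of the form $n=a_1+a_2+\cdots+a_k$ (with $k\ge 1$ arbitrary and the $a_i$ positive integers) in which $a_{i+1}$ is a proper divisor of $a_i$ for all $i<k$; equivalently, partitions into distinct parts in which every part is a multiple of the next part. For real $x$, $A(x)=\sum_{n\le x}a(n)$, the sum being over positive integers $n\le x$. $\zeta$ is the Riemann zeta function and $\zeta'$ its derivative; $\rho\approx 1.73$, and $\zeta'(\rho)<0$. It is a known theorem of Erdős and Loxton that there exists a positive constant $c$ with $A(x)\sim c\,x^{\rho}$ as $x\to\infty$; this is the constant $c$ in the claim. *)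

theory Defs
  imports "HOL-Analysis.Analysis" "HOL-Library.Landau_Symbols"
begin

text \<open>
  The Riemann zeta function, given by its Dirichlet series. The value is only meaningful for
  \<open>s > 1\<close>, where the series converges; no other arguments are used below.
\<close>
definition zeta :: "real \<Rightarrow> real" where
  "zeta s = (\<Sum>n. 1 / real (Suc n) powr s)"

definition rho :: real where
  "rho = (THE s. 1 < s \<and> zeta s = 2)"

text \<open>
  A partition is the list of its parts in decreasing order. The number 1 counts as a proper
  divisor of every larger number. The set is finite, since all parts are positive.
\<close>
definition divisor_chain_partitions :: "nat \<Rightarrow> nat list set" where
  "divisor_chain_partitions n =
     {xs. xs \<noteq> [] \<and> (\<forall>x\<in>set xs. 0 < x) \<and> sum_list xs = n \<and>
          successively (\<lambda>x y. y dvd x \<and> y \<noteq> x) xs}"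

definition a :: "nat \<Rightarrow> nat" where
  "a n = card (divisor_chain_partitions n)"

definition A :: "real \<Rightarrow> real" where
  "A x = (\<Sum>n | 1 \<le> n \<and> real n \<le> x. real (a n))"

definition tuples :: "nat \<Rightarrow> nat list set" where
  "tuples k = {ds. length ds = k \<and> (\<forall>d\<in>set ds. 1 < d)}"

text \<open>For \<open>ds = [d\<^sub>1, \<dots>, d\<^sub>k]\<close> this is
  \<open>1 / (d\<^sub>1 + d\<^sub>1 d\<^sub>2 + \<dots> + d\<^sub>1 d\<^sub>2 \<cdots> d\<^sub>k) powr s\<close>.\<close>
definition tuple_term :: "real \<Rightarrow> nat list \<Rightarrow> real" where
  "tuple_term s ds = 1 / real (\<Sum>j=1..length ds. prod_list (take j ds)) powr s"

end

theory Submission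
  imports Defs
begin

text \<open>
  A partition \<open>n = a\<^sub>1 + \<dots> + a\<^sub>k\<close> of the required kind is determined by its smallest part
  \<open>m \<ge> 1\<close> and the ratios \<open>d\<^sub>1, d\<^sub>2, \<dots> > 1\<close> of consecutive parts, read upwards, and then
  \<open>n = m (1 + X)\<close> with \<open>X = d\<^sub>1 + d\<^sub>1 d\<^sub>2 + \<dots>\<close> the \<open>weight\<close> of the tuple of ratios. Hence for
  \<open>s > \<rho>\<close> the Dirichlet series \<open>F(s) = \<Sum> a(n) n\<^sup>-\<^sup>s\<close> is \<open>\<zeta>(s) G(s)\<close>, where \<open>G(s)\<close>
  (\<open>shifted_total\<close>) is the sum of \<open>(1 + X)\<^sup>-\<^sup>s\<close> over tuples of every length.

  Adding a ratio \<open>d\<close> in front of a tuple turns \<open>X\<close> into \<open>d (1 + X)\<close>. So the sum of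
  \<open>X\<^sup>-\<^sup>s\<close> over the tuples of length \<open>k + 1\<close> is \<open>\<zeta>(s) - 1\<close> times the sum \<open>T\<^sub>k(s)\<close>
  (\<open>shifted_sum\<close>) of \<open>(1 + X)\<^sup>-\<^sup>s\<close> over those of length \<open>k\<close>. Two consequences follow.
  Over all nonempty tuples, \<open>X\<^sup>-\<^sup>s\<close> sums to \<open>(\<zeta>(s) - 1) G(s)\<close>, whereas \<open>(1 + X)\<^sup>-\<^sup>s\<close> sums to
  \<open>G(s) - 1\<close>. With the \<open>defect\<close> \<open>E(s) = \<Sum> (X\<^sup>-\<^sup>s - (1 + X)\<^sup>-\<^sup>s)\<close>, taken over nonempty tuples,
  this says \<open>(2 - \<zeta>(s)) G(s) = 1 - E(s)\<close> (\<open>shifted_total_eq\<close>). At \<open>s = \<rho>\<close>, where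
  \<open>\<zeta>(\<rho>) - 1 = 1\<close>, the sum in the theorem is \<open>T\<^bsub>k-1\<^esub>(\<rho>)\<close>, and grouping \<open>E(\<rho>)\<close> by the length of
  the tuple gives the telescoping series \<open>\<Sum> (T\<^sub>k(\<rho>) - T\<^bsub>k+1\<^esub>(\<rho>))\<close>; therefore the limit \<open>L\<close> in
  the theorem exists and is \<open>1 - E(\<rho>)\<close> (\<open>shifted_sum_tendsto\<close>).

  The terms of \<open>E\<close> are \<open>O(X\<^bsup>-s-1\<^esup>)\<close>, one power better than those of \<open>G\<close>, so \<open>E\<close> is continuous
  up to and including \<open>\<rho>\<close> (\<open>continuous_on_defect\<close>). Consequently
  \<open>(2 - \<zeta>(s)) F(s) = \<zeta>(s) (1 - E(s))\<close> tends to \<open>2 L\<close> as \<open>s\<close> decreases to \<open>\<rho>\<close>. On the other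
  hand, \<open>A(x) \<sim> c x\<^sup>\<rho>\<close> forces \<open>(s - \<rho>) F(s)\<close> to tend to \<open>\<rho> c\<close> (\<open>abelian_limit\<close>), and
  \<open>(2 - \<zeta>(s)) / (s - \<rho>)\<close> tends to \<open>-\<zeta>'(\<rho>)\<close>. Comparing the two limits gives
  \<open>- \<rho> c \<zeta>'(\<rho>) = 2 L\<close>.
\<close>

section \<open>The zeta function on \<open>(1, \<infinity>)\<close>\<close>

lemma zeta_sums:
  assumes "s > 1"
  shows "(\<lambda>n. 1 / real (Suc n) powr s) sums zeta s"
proof -
  have "summable (\<lambda>n. real n powr - s)"
    using assms by (simp add: summable_real_powr_iff)
  then have "summable (\<lambda>n. real (Suc n) powr - s)"
    by (subst summable_Suc_iff)
  then show ?thesis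
    unfolding zeta_def by (simp add: powr_minus_divide summable_sums)
qed

lemma zeta_has_sum:
  assumes "s > 1"
  shows "((\<lambda>m. real m powr - s) has_sum zeta s) {1..}"
proof -
  have "((\<lambda>n. 1 / real (Suc n) powr s) has_sum zeta s) UNIV"
    by (rule sums_nonneg_imp_has_sum[OF zeta_sums[OF assms]]) auto
  then have "((\<lambda>m. real m powr - s) \<circ> Suc has_sum zeta s) UNIV"
    by (simp add: o_def powr_minus_divide)
  then have "((\<lambda>m. real m powr - s) has_sum zeta s) (range Suc)"
    by (subst has_sum_reindex) auto
  moreover have "range Suc = {1..}"
    by (auto simp: image_iff Suc_le_eq gr0_conv_Suc)
  ultimately show ?thesis by simp
qed

lemma zeta_minus_1_has_sum:
  assumes "s > 1"
  shows "((\<lambda>m. real m powr - s) has_sum zeta s - 1) {2..}"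
proof -
  have s2: "(\<lambda>m. real m powr - s) summable_on {2..}"
    by (rule summable_on_subset[OF has_sum_imp_summable[OF zeta_has_sum[OF assms]]]) auto
  then have "((\<lambda>m. real m powr - s) has_sum (real 1 powr - s + infsum (\<lambda>m. real m powr - s) {2..}))
      (insert 1 {2..})"
    by (intro has_sum_insert) auto
  moreover have "insert 1 {2..} = {1::nat..}" by auto
  ultimately have "1 + infsum (\<lambda>m. real m powr - s) {2..} = zeta s"
    using has_sum_unique[OF zeta_has_sum[OF assms]] by simp
  then show ?thesis using has_sum_infsum[OF s2] by (metis add_diff_cancel_left')
qed

lemma ln_mult_powr_minus_le:
  fixes x \<epsilon> s t :: real
  assumes "x \<ge> 1" "\<epsilon> > 0" "s + \<epsilon> \<le> t"
  shows "ln x * x powr - t \<le> x powr - s / \<epsilon>"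
proof -
  have "ln x * x powr - t \<le> x powr \<epsilon> / \<epsilon> * x powr - t"
    using assms ln_powr_bound[of x \<epsilon>] by (intro mult_right_mono) auto
  also have "\<dots> = x powr (\<epsilon> - t) / \<epsilon>"
    by (simp add: powr_add[symmetric])
  also have "\<dots> \<le> x powr - s / \<epsilon>"
    using assms by (intro divide_right_mono powr_mono) auto
  finally show ?thesis .
qed

text \<open>
  The series may be differentiated termwise because near \<open>s\<close> the differentiated series is
  dominated by a convergent zeta series: the logarithm costs an arbitrarily small power, by
  \<open>ln_mult_powr_minus_le\<close>. Every term of the differentiated series is at most \<open>0\<close>, and the one
  with \<open>ln 2\<close> is negative.
\<close>

lemma zeta_has_negative_derivative:
  assumes "s > 1"
  obtains D where "(zeta has_field_derivative D) (at s)" "D < 0"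
proof -
  \<comment> \<open>One third of the distance from \<open>1\<close> to \<open>s\<close> goes to the convergence of the majorant, one
    third to the logarithm, and one third keeps \<open>s\<close> in the interior of the region.\<close>
  define \<epsilon> where "\<epsilon> = (s - 1) / 3"
  have \<epsilon>: "\<epsilon> > 0" using assms by (simp add: \<epsilon>_def)
  define f where "f = (\<lambda>n s. 1 / real (Suc n) powr s)"
  define f' where "f' = (\<lambda>n s. - (ln (real (Suc n)) * real (Suc n) powr - s))"
  define S where "S = {1 + 2 * \<epsilon> <..}"
  have bound: "norm (f' n t) \<le> real (Suc n) powr - (1 + \<epsilon>) / \<epsilon>" if "t \<in> S" for n t
  proof -
    have "norm (f' n t) = ln (real (Suc n)) * real (Suc n) powr - t"
      by (simp add: f'_def)
    also have "\<dots> \<le> real (Suc n) powr - (1 + \<epsilon>) / \<epsilon>"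
      using that \<epsilon> by (intro ln_mult_powr_minus_le) (auto simp: S_def)
    finally show ?thesis .
  qed
  have "summable (\<lambda>n. real (Suc n) powr - (1 + \<epsilon>) / \<epsilon>)"
    using zeta_sums[of "1 + \<epsilon>"] \<epsilon> unfolding powr_minus_divide
    by (intro summable_divide) (simp add: sums_iff)
  note M = bound this
  have unif: "uniformly_convergent_on S (\<lambda>n x. \<Sum>i<n. f' i x)"
    by (rule Weierstrass_m_test'[OF M])
  have mem: "s \<in> S" using assms by (simp add: S_def \<epsilon>_def field_simps)
  have deriv: "(f n has_field_derivative f' n x) (at x within S)" for n x
  proof -
    have "f n = (\<lambda>x. exp (- x * ln (real (Suc n))))"
      by (simp add: f_def powr_def exp_minus field_simps)
    then show ?thesis
      unfolding f'_def by (auto intro!: derivative_eq_intros simp: powr_def)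
  qed
  have "((\<lambda>x. \<Sum>n. f n x) has_field_derivative (\<Sum>n. f' n s)) (at s)"
  proof (rule has_field_derivative_series'(2))
    show "convex S" by (simp add: S_def)
    show "summable (\<lambda>n. f n s)"
      using zeta_sums[OF assms] by (simp add: f_def sums_iff)
    show "s \<in> interior S" using mem by (simp add: S_def interior_open)
  qed (use deriv unif mem in auto)
  moreover have "(\<Sum>n. f' n s) < 0"
  proof -
    have summ: "summable (\<lambda>n. - f' n s)"
      using M(1)[OF mem] summable_comparison_test'[OF M(2), of 0 "\<lambda>n. - f' n s"] by simp
    have "0 < (\<Sum>n. - f' n s)"
      by (rule suminf_pos2[OF summ, of 1]) (auto simp: f'_def)
    then show ?thesis using summ by (simp add: suminf_minus summable_minus_iff)
  qed
  moreover have "(\<lambda>x. \<Sum>n. f n x) = zeta" by (simp add: f_def zeta_def fun_eq_iff)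
  ultimately show ?thesis using that by simp
qed

lemma zeta_strict_antimono:
  assumes "1 < s" "s < t"
  shows "zeta t < zeta s"
proof (rule DERIV_neg_imp_decreasing[OF assms(2)])
  fix x assume "s \<le> x" "x \<le> t"
  then show "\<exists>y. (zeta has_real_derivative y) (at x) \<and> y < 0"
    using zeta_has_negative_derivative[of x] assms by auto
qed

text \<open>
  Already \<open>1 + 1/2 + 1/3 + 1/4 > 2\<close>, so by continuity four terms of the series exceed \<open>2\<close> for
  some \<open>s > 1\<close>.
\<close>

lemma zeta_greater_2: "\<exists>s>1. zeta s > 2"
proof -
  define p where "p = (\<lambda>s. \<Sum>n<4. 1 / real (Suc n) powr s)"
  have "p 1 > 2" by (simp add: p_def eval_nat_numeral)
  moreover have "isCont p 1" unfolding p_def by (intro continuous_intros) auto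
  then have "(p \<longlongrightarrow> p 1) (at_right 1)"
    by (simp add: continuous_within filterlim_at_split)
  ultimately have "eventually (\<lambda>s. p s > 2) (at_right 1)"
    by (simp add: order_tendstoD)
  moreover have "eventually (\<lambda>s. s > 1) (at_right (1::real))"
    by (rule eventually_at_right_less)
  ultimately have "eventually (\<lambda>s. s > 1 \<and> p s > 2) (at_right (1::real))"
    by eventually_elim simp
  then obtain s :: real where s: "s > 1" "p s > 2"
    using eventually_happens'[OF trivial_limit_at_right_real] by blast
  have "p s \<le> zeta s"
    unfolding p_def zeta_def
    using zeta_sums[OF s(1)] by (intro sum_le_suminf) (auto simp: sums_iff)
  with s show ?thesis by force
qed

text \<open>
  Replacing one factor \<open>1/m \<le> 1/2\<close> reduces the estimate to \<open>\<zeta>(2) = \<pi>\<^sup>2/6\<close>, and then the crude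
  bound \<open>\<pi> < 4\<close> is enough.
\<close>

lemma zeta_3_less_2: "zeta 3 < 2"
proof -
  have z2: "zeta 2 = pi\<^sup>2 / 6"
    using inverse_squares_sums by (simp add: zeta_def sums_iff add.commute)
  have "zeta 3 - 1 \<le> (zeta 2 - 1) / 2"
  proof (rule has_sum_mono[OF zeta_minus_1_has_sum])
    show "((\<lambda>m. real m powr - 2 / 2) has_sum (zeta 2 - 1) / 2) {2..}"
      by (intro has_sum_divide_const zeta_minus_1_has_sum) auto
    fix m :: nat assume "m \<in> {2..}"
    then show "real m powr - 3 \<le> real m powr - 2 / 2"
      by (simp add: powr_minus_divide field_simps) (simp add: power2_eq_square power3_eq_cube mult_right_mono)
  qed auto
  moreover have "pi\<^sup>2 < 4\<^sup>2" using pi_less_4 by (intro power_strict_mono) auto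
  ultimately show ?thesis by (simp add: z2)
qed

lemma rho_unique: "\<exists>!s. 1 < s \<and> zeta s = 2"
proof -
  obtain l where l: "l > 1" "zeta l > 2" using zeta_greater_2 by blast
  have "l \<le> 3" using zeta_strict_antimono[of 3 l] l zeta_3_less_2 by (cases "l \<le> 3") auto
  moreover have "isCont zeta x" if "x > 1" for x
    using zeta_has_negative_derivative[OF that] DERIV_isCont by blast
  ultimately obtain s where "l \<le> s" "zeta s = 2"
    using IVT2[of zeta 3 2 l] l zeta_3_less_2 by force
  moreover have "t = s" if "1 < t" "zeta t = 2" "1 < s" "zeta s = 2" for s t
    using zeta_strict_antimono[of s t] zeta_strict_antimono[of t s] that by force
  ultimately show ?thesis using l by (metis less_le_trans)
qed

lemma rho_gt_1: "rho > 1" and zeta_rho: "zeta rho = 2"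
  using theI'[OF rho_unique] by (auto simp: rho_def)

section \<open>Divisor chains as tuples of ratios\<close>

definition weight :: "nat list \<Rightarrow> nat" where
  "weight ds = (\<Sum>j=1..length ds. prod_list (take j ds))"

abbreviation all_tuples :: "nat list set" where
  "all_tuples \<equiv> {ds. \<forall>d\<in>set ds. 1 < d}"

lemma weight_Nil [simp]: "weight [] = 0"
  by (simp add: weight_def)

text \<open>
  The recursion behind all the identities below: the first ratio is a factor of every summand.
\<close>

lemma weight_Cons [simp]: "weight (d # ds) = d * (1 + weight ds)"
proof -
  have "weight (d # ds) = (\<Sum>j<Suc (length ds). prod_list (take (Suc j) (d # ds)))"
    unfolding weight_def by (rule sum.reindex_bij_witness[of _ Suc "\<lambda>j. j - 1"]) auto
  also have "\<dots> = d + (\<Sum>j<length ds. d * prod_list (take (Suc j) ds))"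
    by (simp add: sum.lessThan_Suc_shift del: sum.lessThan_Suc)
  also have "(\<Sum>j<length ds. d * prod_list (take (Suc j) ds)) = d * weight ds"
    unfolding weight_def sum_distrib_left
    by (rule sum.reindex_bij_witness[of _ "\<lambda>j. j - 1" Suc]) auto
  finally show ?thesis by (simp add: algebra_simps)
qed

lemma weight_pos: "ds \<in> all_tuples \<Longrightarrow> ds \<noteq> [] \<Longrightarrow> weight ds > 0"
  by (cases ds) auto

lemma tuple_term_eq: "tuple_term s ds = real (weight ds) powr - s"
  by (simp add: tuple_term_def weight_def powr_minus_divide)

text \<open>
  The parts in increasing order, rebuilt from the smallest part and the successive ratios.
\<close>

fun chain :: "nat \<Rightarrow> nat list \<Rightarrow> nat list" where
  "chain m [] = [m]"
| "chain m (d # ds) = m # chain (m * d) ds"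

lemma chain_neq_Nil [simp]: "chain m ds \<noteq> []"
  by (cases ds) auto

lemma Nil_neq_chain [simp]: "[] \<noteq> chain m ds"
  by (metis chain_neq_Nil)

lemma hd_chain [simp]: "hd (chain m ds) = m"
  by (cases ds) auto

lemma sum_list_chain: "sum_list (chain m ds) = m * (1 + weight ds)"
  by (induction m ds rule: chain.induct) (auto simp: algebra_simps)

lemma chain_inject:
  assumes "0 < m" "ds \<in> all_tuples" "chain m ds = chain m' ds'"
  shows "m = m' \<and> ds = ds'"
  using assms
proof (induction m ds arbitrary: m' ds' rule: chain.induct)
  case (1 m)
  then show ?case by (cases ds') auto
next
  case (2 m d ds)
  from "2.prems" obtain d' ds'' where ds': "ds' = d' # ds''" 
    and eq: "m = m'" "chain (m * d) ds = chain (m' * d') ds''"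
    by (cases ds') auto
  have "m * d = m' * d' \<and> ds = ds''"
    using "2.prems" eq by (intro "2.IH") auto
  then show ?case using eq ds' \<open>0 < m\<close> by simp
qed

text \<open>
  A chain of proper divisors determines its ratios: each part is the previous one times an
  integer, which exceeds \<open>1\<close> because the divisor is proper.
\<close>

lemma successively_divides_iff_chain:
  "(\<exists>m ds. ys = chain m ds \<and> 0 < m \<and> ds \<in> all_tuples) \<longleftrightarrow>
   ys \<noteq> [] \<and> (\<forall>y\<in>set ys. 0 < y) \<and> successively (\<lambda>x y. x dvd y \<and> x \<noteq> y) ys"
    (is "?L ys \<longleftrightarrow> ?R ys")
proof
  have chain_R: "0 < m \<Longrightarrow> ds \<in> all_tuples \<Longrightarrow> ?R (chain m ds)" for m ds
    by (induction m ds rule: chain.induct) (auto simp: successively_Cons)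
  assume "?L ys"
  then show "?R ys" using chain_R by (elim exE conjE) (hypsubst, blast)
next
  show "?R ys \<Longrightarrow> ?L ys"
  proof (induction ys rule: induct_list012)
    case 1
    then show ?case by simp
  next
    case (2 y)
    then show ?case by (intro exI[of _ y] exI[of _ "[]"]) auto
  next
    case (3 y z zs)
    from "3.prems" have "?R (z # zs)" by simp
    from "3.IH"(2)[OF this] obtain m ds
      where IH: "z # zs = chain m ds" "0 < m" "ds \<in> all_tuples" by (elim exE conjE)
    have "m = z" using arg_cong[OF IH(1), of hd] by simp
    from "3.prems" have y: "0 < y" and "0 < z" "y dvd z" "y \<noteq> z" by simp_all
    then obtain d where d: "z = y * d" by (metis dvdE)
    have "d > 1" using \<open>0 < z\<close> \<open>y \<noteq> z\<close> d by (cases d) auto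
    with IH y \<open>m = z\<close> d show ?case
      by (intro exI[of _ y] exI[of _ "d # ds"]) simp
  qed
qed

definition chain_codes :: "nat \<Rightarrow> (nat \<times> nat list) set" where
  "chain_codes n = {(m, ds). 0 < m \<and> ds \<in> all_tuples \<and> m * (1 + weight ds) = n}"

lemma bij_betw_chain_codes:
  "bij_betw (\<lambda>(m, ds). rev (chain m ds)) (chain_codes n) (divisor_chain_partitions n)"
  unfolding bij_betw_def
proof
  show "inj_on (\<lambda>(m, ds). rev (chain m ds)) (chain_codes n)"
    using chain_inject by (fastforce simp: inj_on_def chain_codes_def)
  show "(\<lambda>(m, ds). rev (chain m ds)) ` chain_codes n = divisor_chain_partitions n"
  proof (rule set_eqI)
    fix xs
    have "xs \<in> (\<lambda>(m, ds). rev (chain m ds)) ` chain_codes n \<longleftrightarrow>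
        (\<exists>m ds. rev xs = chain m ds \<and> (m, ds) \<in> chain_codes n)"
      by (force simp: rev_swap)
    also have "\<dots> \<longleftrightarrow>
        (\<exists>m ds. rev xs = chain m ds \<and> 0 < m \<and> ds \<in> all_tuples) \<and> sum_list (rev xs) = n"
      by (simp only: chain_codes_def mem_Collect_eq case_prod_conv sum_list_chain[symmetric]) metis
    also have "\<dots> \<longleftrightarrow> xs \<in> divisor_chain_partitions n"
      unfolding successively_divides_iff_chain divisor_chain_partitions_def
      by (auto simp: successively_rev sum_list_rev)
    finally show "xs \<in> (\<lambda>(m, ds). rev (chain m ds)) ` chain_codes n \<longleftrightarrow>
      xs \<in> divisor_chain_partitions n" .
  qed
qed

lemma finite_divisor_chain_partitions: "finite (divisor_chain_partitions n)"
proof (rule finite_subset)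
  have len: "length xs \<le> sum_list xs" if "\<forall>x\<in>set xs. 0 < x" for xs :: "nat list"
    using that by (induction xs) (auto simp: Suc_le_eq)
  show "divisor_chain_partitions n \<subseteq> {xs. set xs \<subseteq> {..n} \<and> length xs \<le> n}"
    using len by (auto simp: divisor_chain_partitions_def intro: member_le_sum_list)
  show "finite {xs. set xs \<subseteq> {..n} \<and> length xs \<le> n}"
    by (rule finite_lists_length_le) simp
qed

text \<open>
  The finiteness is needed along with the count, since the cardinality of an infinite set would
  be \<open>0\<close>.
\<close>

lemma A_eq_card:
  "finite {(m, ds). 0 < m \<and> ds \<in> all_tuples \<and> m * (1 + weight ds) \<le> n}" (is "finite ?C")
  "A (real n) = card {(m, ds). 0 < m \<and> ds \<in> all_tuples \<and> m * (1 + weight ds) \<le> n}"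
proof -
  have eq: "?C = (\<Union>j\<in>{1..n}. chain_codes j)"
    by (auto simp: chain_codes_def)
  have fin: "finite (chain_codes j)" for j
    using bij_betw_finite[OF bij_betw_chain_codes] finite_divisor_chain_partitions by blast
  show "finite ?C" unfolding eq by (rule finite_UN_I) (use fin in simp_all)
  have codes: "card (chain_codes j) = a j" for j
    unfolding a_def by (rule bij_betw_same_card[OF bij_betw_chain_codes])
  have "card ?C = (\<Sum>j\<in>{1..n}. card (chain_codes j))"
    unfolding eq using fin by (intro card_UN_disjoint) (auto simp: chain_codes_def)
  also have "\<dots> = (\<Sum>j\<in>{1..n}. a j)"
    by (simp only: codes)
  finally have "card ?C = (\<Sum>j\<in>{1..n}. a j)" .
  moreover have "{k. 1 \<le> k \<and> real k \<le> real n} = {1..n}" by auto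
  ultimately show "A (real n) = card ?C"
    by (simp only: A_def of_nat_sum)
qed

section \<open>Sums over tuples\<close>

lemma has_sum_minus:
  fixes f g :: "'i \<Rightarrow> real"
  assumes "(f has_sum u) I" "(g has_sum v) I"
  shows "((\<lambda>i. f i - g i) has_sum u - v) I"
  using has_sum_add[OF assms(1) has_sum_uminusI[OF assms(2)]] by simp

lemma has_sum_product_nonneg:
  fixes f :: "'i \<Rightarrow> real" and g :: "'j \<Rightarrow> real"
  assumes "(f has_sum u) I" "(g has_sum v) J"
    and "\<And>i. i \<in> I \<Longrightarrow> f i \<ge> 0" "\<And>j. j \<in> J \<Longrightarrow> g j \<ge> 0"
  shows "((\<lambda>(i, j). f i * g j) has_sum u * v) (I \<times> J)"
proof (rule has_sum_SigmaI)
  show "((\<lambda>j. (\<lambda>(i, j). f i * g j) (i, j)) has_sum f i * v) J" for i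
    using has_sum_cmult_right[OF assms(2)] by simp
  then show "(\<lambda>(i, j). f i * g j) summable_on I \<times> J"
    using has_sum_imp_summable[OF has_sum_cmult_left[OF assms(1), of v]]
    by (rule summable_on_SigmaI) (simp add: assms(3,4))
  show "((\<lambda>i. f i * v) has_sum u * v) I"
    by (rule has_sum_cmult_left[OF assms(1)])
qed

text \<open>
  The factor \<open>m\<close> is the smallest part of a partition when \<open>D\<close> is the set of all positive
  integers, and a new first ratio when \<open>D\<close> consists of the integers greater than \<open>1\<close>.
\<close>

lemma scaled_tuples_has_sum:
  fixes D :: "nat set" and U :: "nat list set"
  assumes "((\<lambda>m. real m powr - s) has_sum z) D"
    and "((\<lambda>ds. real (1 + weight ds) powr - s) has_sum b) U"
  shows "((\<lambda>(m, ds). real (m * (1 + weight ds)) powr - s) has_sum z * b) (D \<times> U)"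
proof -
  have "((\<lambda>(m, ds). real m powr - s * real (1 + weight ds) powr - s) has_sum z * b) (D \<times> U)"
    by (rule has_sum_product_nonneg[OF assms]) simp_all
  then show ?thesis
    by (simp only: of_nat_mult powr_mult of_nat_0_le_iff)
qed

lemma weight_Cons_has_sum:
  assumes "s > 1" 
    and "((\<lambda>ds. real (1 + weight ds) powr - s) has_sum b) U"
  shows "((\<lambda>ds. real (weight ds) powr - s) has_sum (zeta s - 1) * b)
    ((\<lambda>(d, ds). d # ds) ` ({2..} \<times> U))"
proof (subst has_sum_reindex)
  show "inj_on (\<lambda>(d, ds). d # ds) ({2..} \<times> U)" by (auto simp: inj_on_def)
  show "((\<lambda>ds. real (weight ds) powr - s) \<circ> (\<lambda>(d, ds). d # ds) has_sum (zeta s - 1) * b) ({2..} \<times> U)"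
    using scaled_tuples_has_sum[OF zeta_minus_1_has_sum[OF assms(1)] assms(2)]
    by (simp add: o_def case_prod_unfold)
qed

lemma tuples_0: "tuples 0 = {[]}"
  by (auto simp: tuples_def)

lemma Cons_in_image_Cons_iff:
  "x # xs \<in> (\<lambda>(d, ds). d # ds) ` (P \<times> Q) \<longleftrightarrow> x \<in> P \<and> xs \<in> Q"
  by (force simp: image_iff)

lemma Nil_notin_image_Cons: "[] \<notin> (\<lambda>(d, ds). d # ds) ` R"
  by (simp add: image_iff case_prod_unfold)

lemma tuples_Suc: "tuples (Suc k) = (\<lambda>(d, ds). d # ds) ` ({2..} \<times> tuples k)"
proof (rule set_eqI)
  fix xs
  show "xs \<in> tuples (Suc k) \<longleftrightarrow> xs \<in> (\<lambda>(d, ds). d # ds) ` ({2..} \<times> tuples k)"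
  proof (cases xs)
    case Nil
    then show ?thesis by (simp only: Nil_notin_image_Cons) (simp add: tuples_def)
  next
    case (Cons y ys)
    then show ?thesis by (simp only: Cons_in_image_Cons_iff) (auto simp: tuples_def)
  qed
qed

lemma all_tuples_minus_Nil:
  "all_tuples - {[]} = (\<lambda>(d, ds). d # ds) ` ({2..} \<times> all_tuples)"
proof (rule set_eqI)
  fix xs
  show "xs \<in> all_tuples - {[]} \<longleftrightarrow> xs \<in> (\<lambda>(d, ds). d # ds) ` ({2..} \<times> all_tuples)"
  proof (cases xs)
    case Nil
    then show ?thesis by (simp only: Nil_notin_image_Cons) simp
  next
    case (Cons y ys)
    then show ?thesis by (simp only: Cons_in_image_Cons_iff) auto
  qed
qed

lemma shifted_term_le:
  assumes "ds \<in> all_tuples" "ds \<noteq> []" "s > 0"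
  shows "real (1 + weight ds) powr - s \<le> real (weight ds) powr - s"
  using weight_pos[OF assms(1,2)] assms(3) by (intro powr_mono2') auto

definition shifted_sum :: "real \<Rightarrow> nat \<Rightarrow> real" where
  "shifted_sum s k = (\<Sum>\<^sub>\<infinity>ds\<in>tuples k. real (1 + weight ds) powr - s)"

lemma shifted_sum_has_sum:
  assumes "s > 1"
  shows "((\<lambda>ds. real (1 + weight ds) powr - s) has_sum shifted_sum s k) (tuples k)"
proof (induction k)
  case 0
  then show ?case unfolding shifted_sum_def by (intro has_sum_infsum) (simp add: tuples_0)
next
  case (Suc k)
  have "(\<lambda>ds. real (weight ds) powr - s) summable_on tuples (Suc k)"
    using weight_Cons_has_sum[OF assms Suc] unfolding tuples_Suc by (rule has_sum_imp_summable)
  then have "(\<lambda>ds. real (1 + weight ds) powr - s) summable_on tuples (Suc k)"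
  proof (rule summable_on_comparison_test)
    fix ds assume "ds \<in> tuples (Suc k)"
    then show "real (1 + weight ds) powr - s \<le> real (weight ds) powr - s"
      using assms by (intro shifted_term_le) (auto simp: tuples_def)
  qed simp
  then show ?case unfolding shifted_sum_def by (rule has_sum_infsum)
qed

text \<open>
  At \<open>s = rho\<close> the factor \<open>zeta s - 1\<close> is \<open>1\<close>, so there the sum over tuples of length
  \<open>k + 1\<close> is exactly the shifted sum for length \<open>k\<close>.
\<close>

lemma tuple_term_has_sum:
  assumes "s > 1"
  shows "((\<lambda>ds. tuple_term s ds) has_sum (zeta s - 1) * shifted_sum s k) (tuples (Suc k))"
  unfolding tuple_term_eq tuples_Suc by (rule weight_Cons_has_sum[OF assms shifted_sum_has_sum[OF assms]])

lemma shifted_sum_0: "shifted_sum s 0 = 1"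
  by (simp add: shifted_sum_def tuples_0)

lemma shifted_sum_nonneg: "shifted_sum s k \<ge> 0"
  unfolding shifted_sum_def by (intro infsum_nonneg) simp

lemma shifted_sum_Suc_le:
  assumes "s > 1"
  shows "shifted_sum s (Suc k) \<le> (zeta s - 1) * shifted_sum s k"
proof (rule has_sum_mono[OF shifted_sum_has_sum[OF assms] tuple_term_has_sum[OF assms]])
  fix ds assume "ds \<in> tuples (Suc k)"
  then show "real (1 + weight ds) powr - s \<le> tuple_term s ds"
    unfolding tuple_term_eq using assms by (intro shifted_term_le) (auto simp: tuples_def)
qed

lemma zeta_ge_1: "s > 1 \<Longrightarrow> zeta s \<ge> 1"
  using has_sum_nonneg[OF zeta_minus_1_has_sum] by force

lemma shifted_sum_le_power:
  assumes "s > 1"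
  shows "shifted_sum s k \<le> (zeta s - 1) ^ k"
proof (induction k)
  case (Suc k)
  have "shifted_sum s (Suc k) \<le> (zeta s - 1) * shifted_sum s k" by (rule shifted_sum_Suc_le[OF assms])
  also have "\<dots> \<le> (zeta s - 1) * (zeta s - 1) ^ k"
    using Suc zeta_ge_1[OF assms] by (intro mult_left_mono) auto
  finally show ?case by simp
qed (simp add: shifted_sum_0)

lemma zeta_less_2: "s > rho \<Longrightarrow> zeta s < 2"
  using zeta_strict_antimono[OF rho_gt_1] zeta_rho by simp

lemma bij_betw_snd_tuples: "bij_betw snd (Sigma UNIV tuples) all_tuples"
  by (rule bij_betw_byWitness[of _ "\<lambda>ds. (length ds, ds)"]) (auto simp: tuples_def)

text \<open>
  For \<open>s > rho\<close> the ratio \<open>zeta s - 1\<close> is below \<open>1\<close>, so the sums over tuples of fixed length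
  are dominated by a geometric series.
\<close>

lemma all_tuples_summable:
  assumes "s > rho"
  shows "(\<lambda>ds. real (1 + weight ds) powr - s) summable_on all_tuples"
proof -
  have s: "s > 1" using assms rho_gt_1 by simp
  have "summable (\<lambda>k. (zeta s - 1) ^ k)"
    using zeta_less_2[OF assms] zeta_ge_1[OF s] by (intro summable_geometric) auto
  then have "summable (shifted_sum s)"
    by (rule summable_comparison_test') (use shifted_sum_le_power[OF s] shifted_sum_nonneg in auto)
  then have "shifted_sum s summable_on UNIV"
    using shifted_sum_nonneg by (intro summable_nonneg_imp_summable_on)
  then have "(\<lambda>p. real (1 + weight (snd p)) powr - s) summable_on Sigma UNIV tuples"
  proof (rule summable_on_SigmaI[rotated])
    show "((\<lambda>ds. real (1 + weight (snd (k, ds))) powr - s) has_sum shifted_sum s k) (tuples k)" for k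
      using shifted_sum_has_sum[OF s] by simp
  qed simp
  then show ?thesis
    by (rule summable_on_reindex_bij_betw[OF bij_betw_snd_tuples, THEN iffD1])
qed

definition shifted_total :: "real \<Rightarrow> real" where
  "shifted_total s = (\<Sum>\<^sub>\<infinity>ds\<in>all_tuples. real (1 + weight ds) powr - s)"

lemma shifted_total_has_sum:
  "s > rho \<Longrightarrow> ((\<lambda>ds. real (1 + weight ds) powr - s) has_sum shifted_total s) all_tuples"
  unfolding shifted_total_def by (intro has_sum_infsum all_tuples_summable)

lemma weight_has_sum:
  assumes "s > rho"
  shows "((\<lambda>ds. real (weight ds) powr - s) has_sum (zeta s - 1) * shifted_total s) (all_tuples - {[]})"
  unfolding all_tuples_minus_Nil
proof (rule weight_Cons_has_sum)
  show "s > 1" using assms rho_gt_1 by simp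
qed (rule shifted_total_has_sum[OF assms])

definition defect :: "real \<Rightarrow> real" where
  "defect s = (\<Sum>\<^sub>\<infinity>ds\<in>all_tuples - {[]}.
     real (weight ds) powr - s - real (1 + weight ds) powr - s)"

text \<open>
  Both the sum of the terms \<open>weight ds powr - s\<close> over nonempty tuples and that of their shifts
  are expressible by \<open>shifted_total\<close>: the former equals \<open>(zeta s - 1) * shifted_total s\<close>, and the
  latter omits only the term \<open>1\<close> of the empty tuple.
\<close>

lemma shifted_total_eq:
  assumes "s > rho"
  shows "(2 - zeta s) * shifted_total s = 1 - defect s"
proof -
  let ?f = "\<lambda>ds. real (1 + weight ds) powr - s"
  have "?f summable_on all_tuples - {[]}"
    by (rule summable_on_subset[OF all_tuples_summable[OF assms]]) auto
  then have *: "(?f has_sum infsum ?f (all_tuples - {[]})) (all_tuples - {[]})"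
    by (rule has_sum_infsum)
  then have "(?f has_sum (?f [] + infsum ?f (all_tuples - {[]}))) (insert [] (all_tuples - {[]}))"
    by (intro has_sum_insert) auto
  moreover have "insert [] (all_tuples - {[]}) = all_tuples" by auto
  ultimately have "(?f has_sum (?f [] + infsum ?f (all_tuples - {[]}))) all_tuples"
    by (simp only:)
  then have "shifted_total s = ?f [] + infsum ?f (all_tuples - {[]})"
    by (rule has_sum_unique[OF shifted_total_has_sum[OF assms]])
  then have "shifted_total s - 1 = infsum ?f (all_tuples - {[]})" by simp
  with * have "(?f has_sum shifted_total s - 1) (all_tuples - {[]})" by (simp only:)
  from has_sum_minus[OF weight_has_sum[OF assms] this]
  have "defect s = (zeta s - 1) * shifted_total s - (shifted_total s - 1)"
    unfolding defect_def by (rule infsumI)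
  then show ?thesis by (simp add: algebra_simps)
qed

lemma powr_minus_diff_bounds:
  fixes x s :: real
  assumes "x > 0" "s > 0"
  shows "0 \<le> x powr - s - (1 + x) powr - s"
    and "x powr - s - (1 + x) powr - s \<le> s * x powr - (s + 1)"
proof -
  show "0 \<le> x powr - s - (1 + x) powr - s"
    using assms powr_mono2'[of "-s" x "1 + x"] by simp
  have "\<exists>z. x < z \<and> z < 1 + x \<and>
      (1 + x) powr - s - x powr - s = (1 + x - x) * (- s * z powr (- s - 1))"
    using assms by (intro MVT2) (auto intro!: derivative_eq_intros simp: powr_diff)
  then obtain z where z: "x < z" "x powr - s - (1 + x) powr - s = s * z powr (- s - 1)"
    by auto
  have "z powr (- s - 1) \<le> x powr (- s - 1)"
    using assms z by (intro powr_mono2') auto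
  then show "x powr - s - (1 + x) powr - s \<le> s * x powr - (s + 1)"
    using z assms by simp
qed

lemma defect_term_bound:
  assumes "ds \<in> all_tuples - {[]}" "s \<in> {rho..rho + 1}"
  shows "norm (real (weight ds) powr - s - real (1 + weight ds) powr - s)
    \<le> (rho + 1) * real (weight ds) powr - (rho + 1)"
proof -
  have w: "real (weight ds) \<ge> 1" using weight_pos[of ds] assms(1) by force
  have s: "s > 0" using assms rho_gt_1 by simp
  have "norm (real (weight ds) powr - s - real (1 + weight ds) powr - s)
      \<le> s * real (weight ds) powr - (s + 1)"
    using powr_minus_diff_bounds[of "real (weight ds)" s] w s by simp
  also have "\<dots> \<le> (rho + 1) * real (weight ds) powr - (rho + 1)"
    using w s assms rho_gt_1 by (intro mult_mono powr_mono) auto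
  finally show ?thesis .
qed

lemma defect_majorant_summable:
  "(\<lambda>ds. (rho + 1) * real (weight ds) powr - (rho + 1)) summable_on (all_tuples - {[]})"
  by (intro summable_on_cmult_right has_sum_imp_summable[OF weight_has_sum]) simp

text \<open>
  The majorant in \<open>defect_term_bound\<close> has exponent \<open>rho + 1\<close>, and \<open>weight_has_sum\<close> shows
  that it is summable; so the series of differences converges uniformly up to \<open>rho\<close>.
\<close>

lemma continuous_on_defect: "continuous_on {rho..rho + 1} defect"
  unfolding defect_def[abs_def]
proof (rule uniform_limit_theorem[OF always_eventually
      Weierstrass_m_test_general[OF defect_term_bound defect_majorant_summable]])
  show "\<forall>X. continuous_on {rho..rho + 1} (\<lambda>s. \<Sum>ds\<in>X.
      real (weight ds) powr - s - real (1 + weight ds) powr - s)"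
  proof (intro allI continuous_on_sum continuous_on_diff)
    fix n :: nat
    show "continuous_on {rho..rho + 1} (\<lambda>s. real n powr - s)"
      by (cases "n = 0") (auto intro!: continuous_intros)
  next
    fix ds show "continuous_on {rho..rho + 1} (\<lambda>s. real (1 + weight ds) powr - s)"
      by (auto intro!: continuous_intros)
  qed
qed auto

text \<open>
  Grouped by length, the defect at \<open>rho\<close> telescopes, since there the unshifted terms of length
  \<open>k + 1\<close> have the same sum as the shifted terms of length \<open>k\<close>.
\<close>

lemma shifted_sum_tendsto:
  shows "shifted_sum rho \<longlonglongrightarrow> 1 - defect rho"
proof -
  let ?g = "\<lambda>ds. real (weight ds) powr - rho - real (1 + weight ds) powr - rho"
  have "?g summable_on all_tuples - {[]}"
    by (rule abs_summable_summable, rule summable_on_comparison_test[OF defect_majorant_summable])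
       (use defect_term_bound[of _ rho] in auto)
  then have defect: "(?g has_sum defect rho) (all_tuples - {[]})"
    unfolding defect_def by (rule has_sum_infsum)
  have "bij_betw snd (Sigma UNIV (\<lambda>k. tuples (Suc k))) (all_tuples - {[]})"
    by (rule bij_betw_byWitness[of _ "\<lambda>ds. (length ds - 1, ds)"]) (auto simp: tuples_def)
  from this defect have "((\<lambda>p. ?g (snd p)) has_sum defect rho) (Sigma UNIV (\<lambda>k. tuples (Suc k)))"
    by (rule has_sum_reindex_bij_betw[THEN iffD2])
  then have "((\<lambda>k. shifted_sum rho k - shifted_sum rho (Suc k)) has_sum defect rho) UNIV"
  proof (rule has_sum_SigmaD)
    fix k
    from has_sum_minus[OF tuple_term_has_sum[OF rho_gt_1, of k] shifted_sum_has_sum[OF rho_gt_1, of "Suc k"]]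
    show "((\<lambda>ds. ?g (snd (k, ds))) has_sum shifted_sum rho k - shifted_sum rho (Suc k)) (tuples (Suc k))"
      by (simp add: zeta_rho tuple_term_eq)
  qed
  then have "(\<lambda>k. shifted_sum rho k - shifted_sum rho (Suc k)) sums defect rho" by (rule has_sum_imp_sums)
  then have "(\<lambda>n. 1 - shifted_sum rho n) \<longlonglongrightarrow> defect rho"
    unfolding sums_def using sum_lessThan_telescope'[of "shifted_sum rho"] by (simp add: shifted_sum_0)
  from tendsto_diff[OF tendsto_const[of 1] this] show ?thesis by simp
qed

section \<open>An Abelian theorem for counting functions\<close>

text \<open>
  The regular summation principle of Toeplitz: averages of a convergent sequence tend to its
  limit when the weight of every single index vanishes in the limit. The head of the sequence is
  then negligible and the tail is uniformly close to \<open>c\<close>.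
\<close>

lemma weighted_average_tendsto:
  fixes w :: "'i \<Rightarrow> nat \<Rightarrow> real" and u :: "nat \<Rightarrow> real"
  assumes w: "\<forall>\<^sub>F x in F. (\<forall>n. w x n \<ge> 0) \<and> w x sums 1"
    and w0: "\<And>n. ((\<lambda>x. w x n) \<longlongrightarrow> 0) F"
    and u: "u \<longlonglongrightarrow> c"
  shows "\<forall>\<^sub>F x in F. summable (\<lambda>n. w x n * u n)"
    and "((\<lambda>x. \<Sum>n. w x n * u n) \<longlongrightarrow> c) F"
proof -
  have "(\<lambda>n. u n - c) \<longlonglongrightarrow> 0" using u by (simp add: LIM_zero)
  then obtain K where K: "\<And>n. \<bar>u n - c\<bar> \<le> K"
    using convergent_imp_Bseq[of "\<lambda>n. u n - c"] by (auto simp: Bseq_def convergent_def)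
  have abs_summable: "summable (\<lambda>n. w x n * \<bar>u n - c\<bar>)"
    if "\<forall>n. w x n \<ge> 0" "w x sums 1" for x
  proof (rule summable_comparison_test'[of "\<lambda>n. w x n * K" 0])
    show "summable (\<lambda>n. w x n * K)" using that(2) by (intro summable_mult2) (simp add: sums_iff)
    show "norm (w x n * \<bar>u n - c\<bar>) \<le> w x n * K" for n
      using that(1) K by (simp add: abs_mult mult_left_mono)
  qed
  have diff_summable: "summable (\<lambda>n. w x n * (u n - c))"
    if "\<forall>n. w x n \<ge> 0" "w x sums 1" for x
    using abs_summable[OF that] that(1)
    by (intro summable_rabs_cancel[of "\<lambda>n. w x n * (u n - c)"]) (simp add: abs_mult)
  have sums: "(\<lambda>n. w x n * u n) sums (c + (\<Sum>n. w x n * (u n - c)))"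
    if "\<forall>n. w x n \<ge> 0" "w x sums 1" for x
    using sums_add[OF sums_mult2[OF that(2), of c] summable_sums[OF diff_summable[OF that]]]
    by (simp add: algebra_simps)
  show "\<forall>\<^sub>F x in F. summable (\<lambda>n. w x n * u n)"
    using w by eventually_elim (use sums in \<open>auto simp: sums_iff\<close>)
  show "((\<lambda>x. \<Sum>n. w x n * u n) \<longlongrightarrow> c) F"
  proof (rule tendstoI)
    fix \<epsilon> :: real assume "\<epsilon> > 0"
    then obtain N where N: "\<And>n. n \<ge> N \<Longrightarrow> \<bar>u n - c\<bar> < \<epsilon> / 2"
      using LIMSEQ_D[OF u, of "\<epsilon> / 2"] by auto
    have "((\<lambda>x. \<Sum>n<N. w x n * \<bar>u n - c\<bar>) \<longlongrightarrow> (\<Sum>n<N. 0 * \<bar>u n - c\<bar>)) F"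
      by (intro tendsto_intros w0)
    then have "\<forall>\<^sub>F x in F. (\<Sum>n<N. w x n * \<bar>u n - c\<bar>) < \<epsilon> / 2"
      using \<open>\<epsilon> > 0\<close> by (intro order_tendstoD) auto
    with w show "\<forall>\<^sub>F x in F. dist (\<Sum>n. w x n * u n) c < \<epsilon>"
    proof eventually_elim
      case (elim x)
      then have nonneg: "\<forall>n. w x n \<ge> 0" and one: "w x sums 1"
        and head: "(\<Sum>n<N. w x n * \<bar>u n - c\<bar>) < \<epsilon> / 2" by auto
      let ?h = "\<lambda>n. if n \<in> {..<N} then w x n * \<bar>u n - c\<bar> else 0"
      have h: "(\<lambda>n. ?h n + w x n * (\<epsilon> / 2)) sums ((\<Sum>n<N. w x n * \<bar>u n - c\<bar>) + 1 * (\<epsilon> / 2))"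
        by (intro sums_add sums_mult2[OF one] sums_If_finite_set) simp
      have "dist (\<Sum>n. w x n * u n) c = \<bar>\<Sum>n. w x n * (u n - c)\<bar>"
        using sums[OF nonneg one] by (simp add: sums_iff dist_real_def)
      also have "\<dots> \<le> (\<Sum>n. \<bar>w x n * (u n - c)\<bar>)"
        using abs_summable[OF nonneg one] nonneg by (intro summable_rabs) (simp add: abs_mult)
      also have "\<dots> = (\<Sum>n. w x n * \<bar>u n - c\<bar>)"
        using nonneg by (simp add: abs_mult)
      also have "\<dots> \<le> (\<Sum>n. ?h n + w x n * (\<epsilon> / 2))"
      proof (rule suminf_le)
        fix n
        show "w x n * \<bar>u n - c\<bar> \<le> ?h n + w x n * (\<epsilon> / 2)"
        proof (cases "n < N")
          case True
          then show ?thesis using nonneg \<open>\<epsilon> > 0\<close> by simp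
        next
          case False
          then have "w x n * \<bar>u n - c\<bar> \<le> w x n * (\<epsilon> / 2)"
            using nonneg N[of n] by (intro mult_left_mono) auto
          then show ?thesis using False by simp
        qed
      next
        show "summable (\<lambda>n. w x n * \<bar>u n - c\<bar>)" by (rule abs_summable[OF nonneg one])
        show "summable (\<lambda>n. ?h n + w x n * (\<epsilon> / 2))" using h by (rule sums_summable)
      qed
      also have "\<dots> < \<epsilon>" using sums_unique[OF h] head by simp
      finally show ?case .
    qed
  qed
qed

lemma powr_minus_differences_sums:
  fixes s :: real
  assumes "s > 0" "M > 0"
  shows "(\<lambda>n. real (n + M) powr - s - real (n + M + 1) powr - s) sums (real M powr - s)"
proof -
  have "((\<lambda>n. real n powr - s) \<longlongrightarrow> 0) sequentially"
    using assms by (intro tendsto_neg_powr filterlim_real_sequentially) simp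
  then have "(\<lambda>n. real (n + M) powr - s) \<longlonglongrightarrow> 0"
    by (rule LIMSEQ_ignore_initial_segment)
  from telescope_sums'[OF this] show ?thesis by simp
qed

lemma powr_minus_differences_has_sum:
  fixes s :: real
  assumes "s > 0" "M > 0"
  shows "((\<lambda>n. real n powr - s - real (n + 1) powr - s) has_sum (real M powr - s)) {M..}"
proof -
  let ?f = "\<lambda>n. real n powr - s - real (n + 1) powr - s"
  have "((\<lambda>n. ?f (n + M)) has_sum (real M powr - s)) UNIV"
    using powr_minus_differences_sums[OF assms] 
  proof (rule sums_nonneg_imp_has_sum)
    show "?f (n + M) \<ge> 0" for n
      using assms by (simp add: powr_mono2')
  qed
  then have shifted: "((\<lambda>n. ?f (n + M)) has_sum (real M powr - s)) UNIV" .
  have "bij_betw (\<lambda>n. n + M) UNIV {M..}"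
    by (rule bij_betw_byWitness[of _ "\<lambda>n. n - M"]) auto
  from this shifted show ?thesis
    by (rule has_sum_reindex_bij_betw[THEN iffD1])
qed

text \<open>
  Partial summation without boundary terms: each \<open>(h i) powr - s\<close> is the telescoping sum of the
  differences at all \<open>n \<ge> h i\<close>, and exchanging the two summations of nonnegative terms collects, at
  each \<open>n\<close>, the number of indices with \<open>h i \<le> n\<close>.
\<close>

lemma counting_function_sums:
  fixes h :: "'i \<Rightarrow> nat" and s :: real
  assumes s: "s > 0" and pos: "\<And>i. i \<in> I \<Longrightarrow> h i > 0"
    and F: "((\<lambda>i. real (h i) powr - s) has_sum F) I"
    and fin: "\<And>n. finite {i \<in> I. h i \<le> n}"
  shows "(\<lambda>n. real (card {i \<in> I. h i \<le> n}) * (real n powr - s - real (n + 1) powr - s)) sums F"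
proof -
  let ?f = "\<lambda>n. real n powr - s - real (n + 1) powr - s"
  have inner: "((\<lambda>n. ?f (snd (i, n))) has_sum real (h i) powr - s) {h i..}" if "i \<in> I" for i
    using powr_minus_differences_has_sum[OF s pos[OF that]] by simp
  have nonneg: "?f (snd (i, n)) \<ge> 0" if "i \<in> I" "n \<in> {h i..}" for i n
    using that pos[OF that(1)] s by (simp add: powr_mono2')
  have "((\<lambda>p. ?f (snd p)) has_sum F) (Sigma I (\<lambda>i. {h i..}))"
    by (rule has_sum_SigmaI[OF inner F summable_on_SigmaI[OF inner has_sum_imp_summable[OF F] nonneg]])
  moreover have "bij_betw (\<lambda>(n, i). (i, n)) (Sigma UNIV (\<lambda>n. {i \<in> I. h i \<le> n})) (Sigma I (\<lambda>i. {h i..}))"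
    by (rule bij_betw_byWitness[of _ "\<lambda>(i, n). (n, i)"]) auto
  ultimately have "((\<lambda>p. ?f (snd (case p of (n, i) \<Rightarrow> (i, n)))) has_sum F)
      (Sigma UNIV (\<lambda>n. {i \<in> I. h i \<le> n}))"
    by (rule has_sum_reindex_bij_betw[THEN iffD2, rotated])
  then have "((\<lambda>n. real (card {i \<in> I. h i \<le> n}) * ?f n) has_sum F) UNIV"
  proof (rule has_sum_SigmaD)
    fix n
    have "((\<lambda>i. ?f n) has_sum (\<Sum>i\<in>{i \<in> I. h i \<le> n}. ?f n)) {i \<in> I. h i \<le> n}"
      by (rule has_sum_finite[OF fin])
    then show "((\<lambda>i. ?f (snd (case (n, i) of (n, i) \<Rightarrow> (i, n)))) has_sum
        real (card {i \<in> I. h i \<le> n}) * ?f n) {i \<in> I. h i \<le> n}"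
      by (simp only: case_prod_conv snd_conv sum_constant)
  qed
  then show ?thesis by (rule has_sum_imp_sums)
qed

text \<open>
  By Cauchy's mean value theorem the ratio of the differences of \<open>x powr - s\<close> and
  \<open>x powr - (s - r)\<close> over \<open>[x, x + 1]\<close> is \<open>s / (s - r) * z powr - r\<close> for some intermediate \<open>z\<close>. Thus
  \<open>(s - r) * x powr r\<close> times the former difference is, up to the factor \<open>s\<close> and a factor tending
  to \<open>1\<close> for large \<open>x\<close>, the latter difference; summed over \<open>x = 1, 2, \<dots>\<close>, the latter telescopes to \<open>1\<close>.
\<close>

lemma powr_minus_difference_ratio:
  fixes x r s :: real
  assumes "x > 0" "r > 0" "s > r"
  defines "\<delta> \<equiv> s - r"
  defines "\<Delta> \<equiv> x powr - \<delta> - (x + 1) powr - \<delta>"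
  shows "(s - r) * (x powr r * (x powr - s - (x + 1) powr - s)) \<le> s * \<Delta>"
    and "s * ((x / (x + 1)) powr r * \<Delta>) \<le> (s - r) * (x powr r * (x powr - s - (x + 1) powr - s))"
proof -
  have \<delta>: "\<delta> > 0" using assms by (simp add: \<delta>_def)
  have "\<exists>z. x < z \<and> z < x + 1 \<and>
      ((x + 1) powr - s - x powr - s) * (- \<delta> * z powr (- \<delta> - 1)) =
      ((x + 1) powr - \<delta> - x powr - \<delta>) * (- s * z powr (- s - 1))"
    using assms(1)
    by (intro GMVT') (auto intro!: derivative_eq_intros continuous_intros simp: powr_diff)
  then obtain z where z: "x < z" "z < x + 1"
    "((x + 1) powr - s - x powr - s) * (- \<delta> * z powr (- \<delta> - 1)) =
      ((x + 1) powr - \<delta> - x powr - \<delta>) * (- s * z powr (- s - 1))" by blast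
  have "z powr (- s - 1) = z powr (- \<delta> - 1) * z powr - r"
    by (simp add: \<delta>_def powr_add[symmetric])
  with z(3) have "z powr (- \<delta> - 1) * (\<delta> * (x powr - s - (x + 1) powr - s)) =
      z powr (- \<delta> - 1) * (s * (\<Delta> * z powr - r))"
    by (simp add: \<Delta>_def algebra_simps)
  then have eq: "\<delta> * (x powr - s - (x + 1) powr - s) = s * (\<Delta> * z powr - r)"
    using z(1) assms(1) by simp
  have eq': "(s - r) * (x powr r * (x powr - s - (x + 1) powr - s)) = s * ((x / z) powr r * \<Delta>)"
  proof -
    have "(s - r) * (x powr r * (x powr - s - (x + 1) powr - s)) =
        x powr r * (\<delta> * (x powr - s - (x + 1) powr - s))"
      by (simp add: \<delta>_def)
    also have "\<dots> = s * ((x powr r * z powr - r) * \<Delta>)"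
      unfolding eq by simp
    also have "x powr r * z powr - r = (x / z) powr r"
      using z(1) assms(1) by (simp add: powr_divide powr_minus_divide)
    finally show ?thesis .
  qed
  have \<Delta>: "\<Delta> \<ge> 0" using assms(1) \<delta> by (simp add: \<Delta>_def powr_mono2')
  have "(x / z) powr r \<le> 1 powr r"
    using z assms(1,2) by (intro powr_mono2) auto
  then have "s * ((x / z) powr r * \<Delta>) \<le> s * (1 * \<Delta>)"
    using assms(2,3) \<Delta> by (intro mult_left_mono mult_right_mono) auto
  then show "(s - r) * (x powr r * (x powr - s - (x + 1) powr - s)) \<le> s * \<Delta>"
    by (simp add: eq')
  have "(x / (x + 1)) powr r \<le> (x / z) powr r"
    using z assms(1,2) by (intro powr_mono2 divide_left_mono) auto
  then show "s * ((x / (x + 1)) powr r * \<Delta>) \<le> (s - r) * (x powr r * (x powr - s - (x + 1) powr - s))"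
    unfolding eq' using assms(2,3) \<Delta> by (intro mult_left_mono mult_right_mono) auto
qed

text \<open>
  By \<open>powr_minus_difference_ratio\<close>, \<open>(s - r) * F s\<close> lies between \<open>s\<close> times two averages, with
  the same weights, of sequences that both tend to \<open>c\<close>. The weights at each index vanish as \<open>s\<close>
  tends to \<open>r\<close>, so \<open>weighted_average_tendsto\<close> applies to both.
\<close>

lemma abelian_limit:
  fixes g :: "nat \<Rightarrow> real" and F :: "real \<Rightarrow> real"
  assumes r: "r > 0" and g: "\<And>n. g n \<ge> 0"
    and c: "(\<lambda>n. g n / real n powr r) \<longlonglongrightarrow> c"
    and F: "\<And>s. s > r \<Longrightarrow> (\<lambda>n. g n * (real n powr - s - real (n + 1) powr - s)) sums F s"
    and g0: "g 0 = 0"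
  shows "((\<lambda>s. (s - r) * F s) \<longlongrightarrow> r * c) (at_right r)"
proof -
  \<comment> \<open>Indices are shifted by one: the weights are differences of powers of positive integers.\<close>
  define u where "u n = g (n + 1) / real (n + 1) powr r" for n
  define l where "l n = u n * (real (n + 1) / (real (n + 1) + 1)) powr r" for n
  define w where "w s n = real (n + 1) powr - (s - r) - (real (n + 1) + 1) powr - (s - r)" for s n
  have right: "\<forall>\<^sub>F s in at_right r. s > r" by (rule eventually_at_right_less)
  have w: "\<forall>\<^sub>F s in at_right r. (\<forall>n. w s n \<ge> 0) \<and> w s sums 1"
    using right
  proof eventually_elim
    case (elim s)
    then have "(\<forall>n. w s n \<ge> 0)" by (simp add: w_def powr_mono2')
    moreover have "w s sums 1"
      using powr_minus_differences_sums[of "s - r" 1] elim by (simp add: w_def[abs_def] add_ac)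
    ultimately show ?case by blast
  qed
  have w0: "((\<lambda>s. w s n) \<longlongrightarrow> 0) (at_right r)" for n
  proof -
    have "((\<lambda>s. w s n) \<longlongrightarrow> real (n + 1) powr - (r - r) - (real (n + 1) + 1) powr - (r - r)) (at_right r)"
      unfolding w_def by (intro tendsto_intros) auto
    then show ?thesis by simp
  qed
  have u: "u \<longlonglongrightarrow> c" unfolding u_def by (rule LIMSEQ_ignore_initial_segment[OF c])
  have "(\<lambda>n. real (n + 1) / (real (n + 1) + 1)) \<longlonglongrightarrow> 1"
    using LIMSEQ_ignore_initial_segment[OF LIMSEQ_n_over_Suc_n, of 1] by (simp add: add_ac)
  then have "(\<lambda>n. (real (n + 1) / (real (n + 1) + 1)) powr r) \<longlonglongrightarrow> 1 powr r"
    by (intro tendsto_intros) auto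
  from tendsto_mult[OF u this] have l: "l \<longlonglongrightarrow> c" by (simp add: l_def[abs_def])
  note U = weighted_average_tendsto[OF w w0 u] and L = weighted_average_tendsto[OF w w0 l]
  have id: "((\<lambda>s. s) \<longlongrightarrow> r) (at_right r)" by (rule tendsto_ident_at)
  have bounds: "\<forall>\<^sub>F s in at_right r. s * (\<Sum>n. w s n * l n) \<le> (s - r) * F s \<and>
      (s - r) * F s \<le> s * (\<Sum>n. w s n * u n)"
    using right U(1) L(1)
  proof eventually_elim
    case (elim s)
    define t where "t n = (s - r) * (g (n + 1) * (real (n + 1) powr - s - (real (n + 1) + 1) powr - s))" for n
    have "(\<lambda>n. g (n + 1) * (real (n + 1) powr - s - real (n + 1 + 1) powr - s)) sums F s"
      using F[OF elim(1)] g0 by (subst sums_Suc_iff[simplified Suc_eq_plus1]) simp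
    then have t_sums: "t sums ((s - r) * F s)"
      unfolding t_def by (intro sums_mult) (simp add: add_ac)
    have u_sums: "(\<lambda>n. s * (w s n * u n)) sums (s * (\<Sum>n. w s n * u n))"
      using elim(2) by (intro sums_mult summable_sums)
    have l_sums: "(\<lambda>n. s * (w s n * l n)) sums (s * (\<Sum>n. w s n * l n))"
      using elim(3) by (intro sums_mult summable_sums)
    have "s * (w s n * l n) \<le> t n" "t n \<le> s * (w s n * u n)" for n
    proof -
      let ?x = "real (n + 1)"
      have x: "?x > 0" and u0: "u n \<ge> 0" using g by (simp_all add: u_def)
      have t: "t n = (s - r) * (?x powr r * (?x powr - s - (?x + 1) powr - s)) * u n"
        using x by (simp add: t_def u_def)
      have "(s - r) * (?x powr r * (?x powr - s - (?x + 1) powr - s)) * u n \<le> s * w s n * u n"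
        unfolding w_def using powr_minus_difference_ratio(1)[OF x r elim(1)] u0
        by (rule mult_right_mono)
      then show "t n \<le> s * (w s n * u n)" unfolding t by (simp only: mult.assoc)
      have "s * ((?x / (?x + 1)) powr r * w s n) * u n \<le>
          (s - r) * (?x powr r * (?x powr - s - (?x + 1) powr - s)) * u n"
        unfolding w_def using powr_minus_difference_ratio(2)[OF x r elim(1)] u0
        by (rule mult_right_mono)
      then show "s * (w s n * l n) \<le> t n" unfolding t l_def by (simp only: mult_ac)
    qed
    then show ?case using sums_le[OF _ l_sums t_sums] sums_le[OF _ t_sums u_sums] by blast
  qed
  show ?thesis
  proof (rule tendsto_sandwich)
    show "((\<lambda>s. s * (\<Sum>n. w s n * l n)) \<longlongrightarrow> r * c) (at_right r)"
      by (intro tendsto_mult id L(2))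
    show "((\<lambda>s. s * (\<Sum>n. w s n * u n)) \<longlongrightarrow> r * c) (at_right r)"
      by (intro tendsto_mult id U(2))
  qed (use bounds in \<open>auto elim: eventually_mono\<close>)
qed

section \<open>The constant\<close>

text \<open>
  The right-hand side is the Dirichlet series of \<open>a\<close>, written as a sum over the pairs
  \<open>(m, ds)\<close> that encode all partitions and factored by \<open>scaled_tuples_has_sum\<close>.
\<close>

lemma counting_function_A_sums:
  assumes "s > rho"
  shows "(\<lambda>n. A (real n) * (real n powr - s - real (n + 1) powr - s)) sums (zeta s * shifted_total s)"
proof -
  let ?I = "{1::nat..} \<times> all_tuples"
  let ?h = "\<lambda>(m, ds). m * (1 + weight ds)"
  have s: "s > 1" using assms rho_gt_1 by simp
  have set_eq: "{p \<in> ?I. ?h p \<le> n} = {(m, ds). 0 < m \<and> ds \<in> all_tuples \<and> m * (1 + weight ds) \<le> n}" for n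
    by (auto simp: Suc_le_eq)
  have "((\<lambda>p. real (?h p) powr - s) has_sum zeta s * shifted_total s) ?I"
    using scaled_tuples_has_sum[OF zeta_has_sum[OF s] shifted_total_has_sum[OF assms]]
    by (simp only: case_prod_unfold)
  moreover have "finite {p \<in> ?I. ?h p \<le> n}" for n
    unfolding set_eq by (rule A_eq_card(1))
  ultimately have "(\<lambda>n. real (card {p \<in> ?I. ?h p \<le> n}) * (real n powr - s - real (n + 1) powr - s))
      sums (zeta s * shifted_total s)"
    using s by (intro counting_function_sums) auto
  then show ?thesis
    unfolding set_eq A_eq_card(2) .
qed

theorem corollary4:
  fixes c :: real
  assumes "c > 0"
    and "asymp_equiv A at_top (\<lambda>x. c * x powr rho)"
  shows "(\<forall>k\<ge>1. tuple_term rho summable_on tuples k) \<and>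
    convergent (\<lambda>k. \<Sum>\<^sub>\<infinity>ds\<in>tuples k. tuple_term rho ds) \<and>
    c = - (2 / (rho * deriv zeta rho)) *
        lim (\<lambda>k. \<Sum>\<^sub>\<infinity>ds\<in>tuples k. tuple_term rho ds)"
proof (intro conjI allI impI)
  define S where "S = (\<lambda>k. \<Sum>\<^sub>\<infinity>ds\<in>tuples k. tuple_term rho ds)"
  have S: "(tuple_term rho has_sum shifted_sum rho k) (tuples (Suc k))" for k
    using tuple_term_has_sum[OF rho_gt_1, of k] by (simp add: zeta_rho)
  show "tuple_term rho summable_on tuples k" if "k \<ge> 1" for k
    using has_sum_imp_summable[OF S[of "k - 1"]] that by simp
  have "S (Suc k) = shifted_sum rho k" for k
    unfolding S_def by (rule infsumI[OF S])
  then have "(\<lambda>k. S (Suc k)) \<longlonglongrightarrow> 1 - defect rho"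
    using shifted_sum_tendsto by simp
  then have S_lim: "S \<longlonglongrightarrow> 1 - defect rho"
    by (rule LIMSEQ_imp_Suc)
  then show "convergent (\<lambda>k. \<Sum>\<^sub>\<infinity>ds\<in>tuples k. tuple_term rho ds)"
    unfolding S_def[symmetric] by (rule convergentI)
  obtain D where D: "(zeta has_field_derivative D) (at rho)" "D < 0"
    using zeta_has_negative_derivative[OF rho_gt_1] .
  have right: "\<forall>\<^sub>F s in at_right rho. s \<in> {rho<..<rho + 1}"
    by (rule eventually_at_rightI[of rho "rho + 1"]) auto
  have "(\<lambda>n. A (real n) / real n powr rho) \<longlonglongrightarrow> c"
  proof -
    have "((\<lambda>x. A x / (c * x powr rho)) \<longlongrightarrow> 1) at_top"
      using assms by (intro asymp_equivD_strong) (auto intro!: eventually_at_top_linorderI[of 1])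
    then have "(\<lambda>n. A (real n) / (c * real n powr rho)) \<longlonglongrightarrow> 1"
      by (rule filterlim_compose[OF _ filterlim_real_sequentially])
    from tendsto_mult_left[OF this, of c] show ?thesis using assms(1) by simp
  qed
  moreover have "{n::nat. 1 \<le> n \<and> real n \<le> real 0} = {}" by auto
  then have "A (real 0) = 0" by (simp only: A_def sum.empty)
  moreover have "A (real n) \<ge> 0" for n
    unfolding A_def by (intro sum_nonneg) simp
  ultimately have F_lim: "((\<lambda>s. (s - rho) * (zeta s * shifted_total s)) \<longlongrightarrow> rho * c) (at_right rho)"
    using rho_gt_1 counting_function_A_sums
    by (intro abelian_limit[where g = "\<lambda>n. A (real n)"]) simp_all
  \<comment> \<open>Multiplying by the difference quotient of \<open>zeta\<close> cancels the factor \<open>s - rho\<close> and leaves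
    \<open>(zeta s - 2) * zeta s * shifted_total s\<close>, which the defect evaluates independently.\<close>
  have "((\<lambda>s. (zeta s - zeta rho) / (s - rho)) \<longlongrightarrow> D) (at_right rho)"
    using D(1) by (simp add: has_field_derivative_iff filterlim_at_split)
  from tendsto_mult[OF F_lim this]
  have lim1: "((\<lambda>s. (s - rho) * (zeta s * shifted_total s) * ((zeta s - zeta rho) / (s - rho)))
      \<longlongrightarrow> rho * c * D) (at_right rho)" .
  have "(defect \<longlongrightarrow> defect rho) (at rho within {rho..rho + 1})"
    using continuous_on_defect by (simp add: continuous_on_def)
  then have defect_lim: "(defect \<longlongrightarrow> defect rho) (at_right rho)"
    by (simp add: at_within_Icc_at_right)
  have zeta_lim: "(zeta \<longlongrightarrow> 2) (at_right rho)"
    using DERIV_isCont[OF D(1)] by (simp add: isCont_def zeta_rho filterlim_at_split)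
  have lim2: "((\<lambda>s. - (zeta s * (1 - defect s))) \<longlongrightarrow> - (2 * (1 - defect rho))) (at_right rho)"
    by (intro tendsto_intros defect_lim zeta_lim)
  have "\<forall>\<^sub>F s in at_right rho. (s - rho) * (zeta s * shifted_total s) * ((zeta s - zeta rho) / (s - rho)) =
      - (zeta s * (1 - defect s))"
    using right
  proof eventually_elim
    case (elim s)
    then have "(s - rho) * (zeta s * shifted_total s) * ((zeta s - zeta rho) / (s - rho)) =
        zeta s * shifted_total s * (zeta s - 2)"
      by (simp add: zeta_rho)
    also have "\<dots> = - (zeta s * ((2 - zeta s) * shifted_total s))"
      by (simp add: algebra_simps)
    also have "(2 - zeta s) * shifted_total s = 1 - defect s" using elim by (intro shifted_total_eq) simp
    finally show ?case .
  qed
  then have "((\<lambda>s. - (zeta s * (1 - defect s))) \<longlongrightarrow> rho * c * D) (at_right rho)"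
    using lim1 by (rule Lim_transform_eventually[rotated])
  from tendsto_unique[OF trivial_limit_at_right_real this lim2]
  have "rho * c * D = - (2 * (1 - defect rho))" .
  moreover have "deriv zeta rho = D" by (rule DERIV_imp_deriv[OF D(1)])
  moreover have "lim S = 1 - defect rho" by (rule limI[OF S_lim])
  ultimately have "c = - (2 / (rho * deriv zeta rho)) * lim S"
    using D(2) rho_gt_1 by (simp add: field_simps)
  then show "c = - (2 / (rho * deriv zeta rho)) *
      lim (\<lambda>k. \<Sum>\<^sub>\<infinity>ds\<in>tuples k. tuple_term rho ds)"
    unfolding S_def .
qed

end
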